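(* There exist an absolute constant $c>0$, a sequence of positive integers $n_k\to\infty$, and finite connected weighted undirected graphs $G_k$ with $|G_k|=n_k$ vertices and $\pi_*(G_k)=\frac{1}{n_k}$, such that for every $k$ $$\rho(G_k)\ \ge\ c\,\tau_\infty(G_k)\,\log\log n_k,$$ where $\tau_\infty(G_k)$ is the $L^\infty$ mixing time (with $\epsilon=\tfrac12$) of the continuous-time random walk on $G_k$ and $\rho(G_k)$ is the spectral profile integral of $G_k$.
   Context: A finite weighted undirected graph is a finite vertex set $G$ (with at least two vertices) together with a symmetric weight function $\omega:G\times G\to[0,\infty)$, $\omega(x,y)=\omega(y,x)$; loops, i.e. $\omega(x,x)>0$, are allowed. Put $\omega(x)=\sum_{z}\omega(x,z)$, assumed positive for every $x$. The graph is connected if any two vertices are joined by a path of edges of positive weight. Define the stochastic matrix $K(x,y)=\omega(x,y)/\omega(x)$, the stationary measure $\pi(x)=\omega(x)/\sum_{y}\omega(y)$, $\pi(A)=\sum_{x\in A}\pi(x)$ for $A\subset G$, and $\pi_*=\pi_*(G)=\min_{\emptyset\ne A\subset G}\pi(A)=\min_{x}\pi(x)$. The Laplacian is $\Delta=I-K$, acting by $(\Delta f)(x)=f(x)-\sum_y K(x,y)f(y)$. Write $\langle f,g\rangle=\sum_x f(x)g(x)\pi(x)$ and $\|f\|_p^p=\sum_x |f(x)|^p\pi(x)$. For nonempty $A\subset G$ let $$\lambda(A)=\inf\left\{\frac{\langle \Delta f,f\rangle}{\|f\|_2^2-\|f\|_1^2} : f:G\to[0,\infty),\ \operatorname{supp}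 f\subset A,\ f \text{ not constant on } G\right\}.$$ The spectral profile is $\Lambda(r)=\inf\{\lambda(A): A\subset G,\ 0<\pi(A)\le r\}$ for $r\ge\pi_*$. The spectral profile integral is $$\rho=\rho(G)=\int_{4\pi_*}^{8}\frac{2\,dr}{r\Lambda(r)}.$$ The continuous-time random walk has transition matrix $H_t=e^{-t\Delta}=e^{-t}\sum_{n\ge0}\frac{t^n}{n!}K^n$, and its $L^\infty$ mixing time is $$\tau_\infty=\tau_\infty(G)=\inf\left\{t>0:\ \sup_{x,y\in G}\left|\frac{H_t(x,y)-\pi(y)}{\pi(y)}\right|\le\frac12\right\}.$$ Logarithms are to base $2$. *)

theory Defs
  imports "HOL-Analysis.Analysis"
begin

text \<open>
  A finite weighted graph is given by its vertex set \<open>V\<close> and its weight function \<open>w\<close>. All notions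
  below depend only on the values of \<open>w\<close> on \<open>V \<times> V\<close> and of functions \<open>f\<close> on \<open>V\<close>.
\<close>

definition vertex_weight :: "'a set \<Rightarrow> ('a \<Rightarrow> 'a \<Rightarrow> real) \<Rightarrow> 'a \<Rightarrow> real" where
  "vertex_weight V w x = (\<Sum>z\<in>V. w x z)"

definition weighted_graph :: "'a set \<Rightarrow> ('a \<Rightarrow> 'a \<Rightarrow> real) \<Rightarrow> bool" where
  "weighted_graph V w \<longleftrightarrow>
     finite V \<and> 2 \<le> card V \<and>
     (\<forall>x\<in>V. \<forall>y\<in>V. 0 \<le> w x y) \<and>
     (\<forall>x\<in>V. \<forall>y\<in>V. w x y = w y x) \<and>
     (\<forall>x\<in>V. 0 < vertex_weight V w x)"

definition connected_graph :: "'a set \<Rightarrow> ('a \<Rightarrow> 'a \<Rightarrow> real) \<Rightarrow> bool" where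
  "connected_graph V w \<longleftrightarrow>
     (\<forall>x\<in>V. \<forall>y\<in>V. (x, y) \<in> {(u, v). u \<in> V \<and> v \<in> V \<and> 0 < w u v}\<^sup>*)"

definition transition :: "'a set \<Rightarrow> ('a \<Rightarrow> 'a \<Rightarrow> real) \<Rightarrow> 'a \<Rightarrow> 'a \<Rightarrow> real" where
  "transition V w x y = w x y / vertex_weight V w x"

definition stationary :: "'a set \<Rightarrow> ('a \<Rightarrow> 'a \<Rightarrow> real) \<Rightarrow> 'a \<Rightarrow> real" where
  "stationary V w x = vertex_weight V w x / (\<Sum>y\<in>V. vertex_weight V w y)"

definition stationary_set :: "'a set \<Rightarrow> ('a \<Rightarrow> 'a \<Rightarrow> real) \<Rightarrow> 'a set \<Rightarrow> real" where
  "stationary_set V w A = (\<Sum>x\<in>A. stationary V w x)"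

definition pi_star :: "'a set \<Rightarrow> ('a \<Rightarrow> 'a \<Rightarrow> real) \<Rightarrow> real" where
  "pi_star V w = Min (stationary_set V w ` {A. A \<subseteq> V \<and> A \<noteq> {}})"

definition laplacian :: "'a set \<Rightarrow> ('a \<Rightarrow> 'a \<Rightarrow> real) \<Rightarrow> ('a \<Rightarrow> real) \<Rightarrow> 'a \<Rightarrow> real" where
  "laplacian V w f x = f x - (\<Sum>y\<in>V. transition V w x y * f y)"

definition inner_pi :: "'a set \<Rightarrow> ('a \<Rightarrow> 'a \<Rightarrow> real) \<Rightarrow> ('a \<Rightarrow> real) \<Rightarrow> ('a \<Rightarrow> real) \<Rightarrow> real" where
  "inner_pi V w f g = (\<Sum>x\<in>V. f x * g x * stationary V w x)"

definition norm_pi :: "'a set \<Rightarrow> ('a \<Rightarrow> 'a \<Rightarrow> real) \<Rightarrow> real \<Rightarrow> ('a \<Rightarrow> real) \<Rightarrow> real" where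
  "norm_pi V w p f = (\<Sum>x\<in>V. \<bar>f x\<bar> powr p * stationary V w x) powr (1 / p)"

text \<open>
  The infima below are infima of real sets. They are taken over nonempty sets bounded below by
  \<open>0\<close> in the intended range: \<open>{} \<noteq> A \<subseteq> V\<close> and \<open>r \<ge> pi_star V w\<close>, on a weighted graph.
\<close>

definition set_eigenvalue :: "'a set \<Rightarrow> ('a \<Rightarrow> 'a \<Rightarrow> real) \<Rightarrow> 'a set \<Rightarrow> real" where
  "set_eigenvalue V w A =
     Inf {inner_pi V w (laplacian V w f) f / ((norm_pi V w 2 f)\<^sup>2 - (norm_pi V w 1 f)\<^sup>2) | f.
            (\<forall>x\<in>V. 0 \<le> f x) \<and> {x\<in>V. f x \<noteq> 0} \<subseteq> A \<and> \<not> f constant_on V}"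

definition spectral_profile :: "'a set \<Rightarrow> ('a \<Rightarrow> 'a \<Rightarrow> real) \<Rightarrow> real \<Rightarrow> real" where
  "spectral_profile V w r =
     Inf {set_eigenvalue V w A | A. A \<subseteq> V \<and> 0 < stationary_set V w A \<and> stationary_set V w A \<le> r}"

definition profile_integral :: "'a set \<Rightarrow> ('a \<Rightarrow> 'a \<Rightarrow> real) \<Rightarrow> real" where
  "profile_integral V w = integral {4 * pi_star V w..8} (\<lambda>r. 2 / (r * spectral_profile V w r))"

primrec transition_pow :: "'a set \<Rightarrow> ('a \<Rightarrow> 'a \<Rightarrow> real) \<Rightarrow> nat \<Rightarrow> 'a \<Rightarrow> 'a \<Rightarrow> real" where
  "transition_pow V w 0 x y = (if x = y then 1 else 0)"
| "transition_pow V w (Suc n) x y = (\<Sum>z\<in>V. transition V w x z * transition_pow V w n z y)"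

definition heat_kernel :: "'a set \<Rightarrow> ('a \<Rightarrow> 'a \<Rightarrow> real) \<Rightarrow> real \<Rightarrow> 'a \<Rightarrow> 'a \<Rightarrow> real" where
  "heat_kernel V w t x y = exp (- t) * (\<Sum>n. t ^ n / fact n * transition_pow V w n x y)"

definition mixing_time :: "'a set \<Rightarrow> ('a \<Rightarrow> 'a \<Rightarrow> real) \<Rightarrow> real" where
  "mixing_time V w =
     Inf {t. 0 < t \<and>
            (SUP (x, y)\<in>V \<times> V.
               \<bar>(heat_kernel V w t x y - stationary V w y) / stationary V w y\<bar>) \<le> 1 / 2}"

end

theory Submission
  imports Defs
begin

text \<open>
  If a walk has mixing time \<open>\<tau>\<close>, then a set of small stationary measure \<open>r\<close> must be left at a rate at
  least of order \<open>log (1/r) / \<tau>\<close>, and inserting this bound for \<open>\<Lambda>(r)\<close> in the profile integral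
  gives \<open>\<tau> \<integral> dr / (r log (1/r))\<close>, which is of order \<open>\<tau> log log n\<close>. To attain this order one needs a graph
  which has, at every scale \<open>r = 2 ^ - (2 ^ j)\<close>, a set of measure about \<open>r\<close> that is left
  as slowly as the mixing time permits.

  A hierarchy of nested blocks does this. Split \<open>n = 2 ^ (2 ^ k - 1)\<close> vertices, for each \<open>j \<le> k\<close>, into
  \<open>N\<^sub>j = 2 ^ (2 ^ j - 1)\<close> equal blocks of consecutive integers, and let \<open>E\<^sub>j\<close> be the operator that
  averages over the blocks of level \<open>j\<close>; thus \<open>E\<^sub>0\<close> averages over everything and \<open>E\<^sub>k = I\<close>. The walk
  is \<open>K = (E\<^sub>k + \<Sum>j<k. 2 ^ j E\<^sub>j) / 2 ^ k\<close>. Its weights are symmetric with row sums \<open>1\<close>, so the stationary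
  measure is uniform. The blocks are nested, so \<open>E\<^sub>i E\<^sub>j = E\<^bsub>min i j\<^esub>\<close>, and \<open>K\<close> acts on the range
  of \<open>E\<^sub>j - E\<^bsub>j-1\<^esub>\<close> as multiplication by \<open>1 - \<lambda>\<^sub>j\<close>, where \<open>\<lambda>\<^sub>j = (2 ^ j - 1) / 2 ^ k\<close>. The number of
  blocks and the eigenvalue are tied by \<open>N\<^sub>j = 2 ^ (2 ^ k \<lambda>\<^sub>j)\<close>, and both estimates rest on this.

  \<^item> Mixing (\<open>hier_mixing_time_le\<close>). The kernel of \<open>E\<^sub>j - E\<^bsub>j-1\<^esub>\<close> relative to \<open>\<pi>\<close> is at most \<open>N\<^sub>j\<close>, so
    the deviation from equilibrium at time \<open>t\<close> is at most \<open>\<Sum>j=1..k. N\<^sub>j exp (- t \<lambda>\<^sub>j)\<close>. At \<open>t = 2 * 2 ^ k\<close>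
    the terms are \<open>(2 / e\<^sup>2) ^ (2 ^ j - 1)\<close>, and the sum is at most \<open>1/2\<close>.

  \<^item> Profile (\<open>hier_profile_integral_ge\<close>). The indicator of a block of level \<open>j\<close> is fixed by \<open>E\<^sub>i\<close> for \<open>i \<ge> j\<close>,
    and its Rayleigh quotient is at most \<open>\<Sum>i<j. 2 ^ i / 2 ^ k = \<lambda>\<^sub>j\<close>. Hence \<open>\<Lambda>(1/N\<^sub>j) \<le> \<lambda>\<^sub>j\<close>, and by monotonicity
    of \<open>\<Lambda>\<close> the interval from \<open>1/N\<^sub>j\<close> to \<open>1/N\<^bsub>j-1\<^esub>\<close> contributes at least
    \<open>(2 / \<lambda>\<^sub>j) ln (N\<^sub>j / N\<^bsub>j-1\<^esub>) \<ge> 2 ^ k ln 2\<close>. There are \<open>k - 1\<close> such intervals between \<open>4/n\<close> and \<open>1\<close>.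

  Together \<open>\<rho> \<ge> (k - 1) 2 ^ k ln 2\<close>, while \<open>\<tau> \<le> 2 * 2 ^ k\<close> and \<open>log log n \<le> k\<close>.
\<close>

section \<open>Graphs whose stationary measure is uniform\<close>

locale unit_weight_graph =
  fixes V :: "'a set" and w :: "'a \<Rightarrow> 'a \<Rightarrow> real"
  assumes finite_V: "finite V"
    and card_V: "2 \<le> card V"
    and w_nonneg: "\<And>x y. x \<in> V \<Longrightarrow> y \<in> V \<Longrightarrow> 0 \<le> w x y"
    and w_sym: "\<And>x y. x \<in> V \<Longrightarrow> y \<in> V \<Longrightarrow> w x y = w y x"
    and row_sum: "\<And>x. x \<in> V \<Longrightarrow> (\<Sum>y\<in>V. w x y) = 1"
begin

definition variance :: "('a \<Rightarrow> real) \<Rightarrow> real" where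
  "variance f = (\<Sum>x\<in>V. (f x)\<^sup>2) / card V - ((\<Sum>x\<in>V. f x) / card V)\<^sup>2"

definition dirichlet_form :: "('a \<Rightarrow> real) \<Rightarrow> real" where
  "dirichlet_form f = ((\<Sum>x\<in>V. (f x)\<^sup>2) - (\<Sum>x\<in>V. \<Sum>y\<in>V. w x y * (f x * f y))) / card V"

lemma card_pos: "0 < card V"
  using card_V by linarith

lemma vertex_weight_eq: "x \<in> V \<Longrightarrow> vertex_weight V w x = 1"
  by (simp add: vertex_weight_def row_sum)

lemma weighted_graph: "weighted_graph V w"
  unfolding weighted_graph_def
  using finite_V card_V w_nonneg w_sym by (auto simp: vertex_weight_eq)

lemma transition_eq: "x \<in> V \<Longrightarrow> transition V w x y = w x y"
  by (simp add: transition_def vertex_weight_eq)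

lemma stationary_eq: "x \<in> V \<Longrightarrow> stationary V w x = 1 / card V"
  by (simp add: stationary_def vertex_weight_eq)

lemma stationary_set_eq: "A \<subseteq> V \<Longrightarrow> stationary_set V w A = card A / card V"
  unfolding stationary_set_def
  by (subst sum.cong[OF refl stationary_eq]) auto

lemma pi_star_eq: "pi_star V w = 1 / card V"
  unfolding pi_star_def
proof (rule Min_eqI)
  show "finite (stationary_set V w ` {A. A \<subseteq> V \<and> A \<noteq> {}})"
    using finite_V by simp
next
  fix y assume "y \<in> stationary_set V w ` {A. A \<subseteq> V \<and> A \<noteq> {}}"
  then obtain A where A: "A \<subseteq> V" "A \<noteq> {}" "y = card A / card V"
    using stationary_set_eq by auto
  then have "1 \<le> card A"
    using finite_V by (metis One_nat_def Suc_leI card_gt_0_iff finite_subset)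
  then show "1 / card V \<le> y"
    using A by (simp add: divide_right_mono)
next
  obtain x where "x \<in> V"
    using card_pos by fastforce
  then show "1 / card V \<in> stationary_set V w ` {A. A \<subseteq> V \<and> A \<noteq> {}}"
    by (intro image_eqI[of _ _ "{x}"]) (auto simp: stationary_set_eq)
qed

lemma inner_pi_laplacian: "inner_pi V w (laplacian V w f) f = dirichlet_form f"
proof -
  have "inner_pi V w (laplacian V w f) f
      = (\<Sum>x\<in>V. ((f x)\<^sup>2 - (\<Sum>y\<in>V. w x y * (f x * f y))) / card V)"
    unfolding inner_pi_def laplacian_def
    by (intro sum.cong refl)
      (simp add: stationary_eq transition_eq power2_eq_square algebra_simps sum_distrib_left
        diff_divide_distrib sum_divide_distrib)
  then show ?thesis
    by (simp add: dirichlet_form_def sum_divide_distrib[symmetric] sum_subtractf)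
qed

lemma norm_pi_diff_eq_variance:
  assumes "\<And>x. x \<in> V \<Longrightarrow> 0 \<le> f x"
  shows "(norm_pi V w 2 f)\<^sup>2 - (norm_pi V w 1 f)\<^sup>2 = variance f"
proof -
  let ?S = "\<Sum>x\<in>V. \<bar>f x\<bar> powr 2 * stationary V w x"
  have S: "?S = (\<Sum>x\<in>V. (f x)\<^sup>2) / card V"
    unfolding sum_divide_distrib by (intro sum.cong refl) (simp add: stationary_eq)
  have "0 \<le> ?S" unfolding S by (intro divide_nonneg_nonneg sum_nonneg) auto
  then have "(norm_pi V w 2 f)\<^sup>2 = (\<Sum>x\<in>V. (f x)\<^sup>2) / card V"
    by (simp only: norm_pi_def powr_half_sqrt real_sqrt_pow2 S)
  moreover have "norm_pi V w 1 f = (\<Sum>x\<in>V. f x) / card V"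
  proof -
    have "(\<Sum>x\<in>V. \<bar>f x\<bar> powr 1 * stationary V w x) = (\<Sum>x\<in>V. f x) / card V"
      unfolding sum_divide_distrib
      by (intro sum.cong refl) (simp add: stationary_eq assms)
    then show ?thesis
      by (simp add: norm_pi_def assms sum_nonneg)
  qed
  ultimately show ?thesis
    by (simp add: variance_def)
qed

lemma variance_pos:
  assumes "\<not> f constant_on V"
  shows "0 < variance f"
proof -
  define m where "m = (\<Sum>x\<in>V. f x) / card V"
  have sum_f: "(\<Sum>x\<in>V. f x) = m * card V"
    using card_pos by (simp add: m_def)
  have "(\<Sum>x\<in>V. (f x - m)\<^sup>2) = (\<Sum>x\<in>V. (f x)\<^sup>2) - 2 * m * (\<Sum>x\<in>V. f x) + card V * m\<^sup>2"
    unfolding sum_distrib_left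
    by (simp add: power2_diff sum.distrib sum_subtractf mult.commute mult.left_commute)
  also have "\<dots> = (\<Sum>x\<in>V. (f x)\<^sup>2) - card V * m\<^sup>2"
    unfolding sum_f by (simp add: power2_eq_square algebra_simps)
  finally have eq: "(\<Sum>x\<in>V. (f x - m)\<^sup>2) / card V = variance f"
    using card_pos by (simp add: variance_def m_def[symmetric] diff_divide_distrib)
  obtain x where "x \<in> V" "f x \<noteq> m"
    using assms unfolding constant_on_def by blast
  then have "0 < (\<Sum>x\<in>V. (f x - m)\<^sup>2)"
    by (intro sum_pos2[OF finite_V, of x]) auto
  then show ?thesis
    using card_pos by (simp flip: eq)
qed

lemma indicator_not_constant:
  assumes "A \<subseteq> V" "A \<noteq> {}" "A \<noteq> V"
  shows "\<not> (indicator A :: 'a \<Rightarrow> real) constant_on V"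
proof
  obtain x y where xy: "x \<in> A" "x \<in> V" "y \<in> V" "y \<notin> A"
    using assms by blast
  assume "(indicator A :: 'a \<Rightarrow> real) constant_on V"
  then obtain c where "\<And>z. z \<in> V \<Longrightarrow> indicator A z = (c :: real)"
    unfolding constant_on_def by blast
  from this[of x] this[of y] show False
    using xy by simp
qed

definition rayleigh_quotients :: "'a set \<Rightarrow> real set" where
  "rayleigh_quotients A =
     {inner_pi V w (laplacian V w f) f / ((norm_pi V w 2 f)\<^sup>2 - (norm_pi V w 1 f)\<^sup>2) | f.
        (\<forall>x\<in>V. 0 \<le> f x) \<and> {x\<in>V. f x \<noteq> 0} \<subseteq> A \<and> \<not> f constant_on V}"

text \<open>
  The indicator of \<open>B\<close> is an admissible test function for every set \<open>A\<close> that contains \<open>B\<close>. Singletons show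
  that the infimum defining the eigenvalue of a set is taken over a nonempty set, and \<open>B = A\<close> bounds it from above.
\<close>

lemma indicator_quotient:
  assumes "B \<subseteq> A" "B \<subseteq> V" "B \<noteq> {}" "B \<noteq> V"
  shows "dirichlet_form (indicator B) / variance (indicator B) \<in> rayleigh_quotients A"
proof -
  let ?f = "indicator B :: 'a \<Rightarrow> real"
  have "{x \<in> V. ?f x \<noteq> 0} \<subseteq> A"
    using assms(1) by (auto simp: indicator_def)
  moreover have "\<not> ?f constant_on V"
    using assms(2-4) by (rule indicator_not_constant)
  moreover have "dirichlet_form ?f / variance ?f
      = inner_pi V w (laplacian V w ?f) ?f / ((norm_pi V w 2 ?f)\<^sup>2 - (norm_pi V w 1 ?f)\<^sup>2)"
    by (simp add: norm_pi_diff_eq_variance inner_pi_laplacian)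
  moreover have "\<forall>x\<in>V. 0 \<le> ?f x"
    by simp
  ultimately show ?thesis
    unfolding rayleigh_quotients_def by blast
qed

lemma mixing_time_le:
  assumes "0 < t"
    and "\<And>x y. x \<in> V \<Longrightarrow> y \<in> V \<Longrightarrow> \<bar>card V * heat_kernel V w t x y - 1\<bar> \<le> 1 / 2"
  shows "mixing_time V w \<le> t"
  unfolding mixing_time_def
proof (rule cInf_lower)
  have "\<bar>(heat_kernel V w t x y - stationary V w y) / stationary V w y\<bar> \<le> 1 / 2"
    if "x \<in> V" "y \<in> V" for x y
    using assms(2)[OF that] card_pos that by (simp add: stationary_eq right_diff_distrib mult.commute)
  then have "(SUP (x, y)\<in>V \<times> V.
      \<bar>(heat_kernel V w t x y - stationary V w y) / stationary V w y\<bar>) \<le> 1 / 2"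
    using card_pos by (intro cSUP_least) force+
  then show "t \<in> {t. 0 < t \<and> (SUP (x, y)\<in>V \<times> V.
      \<bar>(heat_kernel V w t x y - stationary V w y) / stationary V w y\<bar>) \<le> 1 / 2}"
    using assms(1) by blast
qed (auto intro: bdd_belowI[of _ 0])

end

text \<open>
  A positive lower bound \<open>\<gamma>\<close> for all Rayleigh quotients gives \<open>\<Lambda> \<ge> \<gamma> > 0\<close>. Then \<open>1 / \<Lambda>\<close> is a bounded
  increasing function; without positivity the value \<open>x / 0 = 0\<close> would destroy both the
  monotonicity and the lower bounds for the integrand.
\<close>

locale spectral_gap_graph = unit_weight_graph V w
  for V :: "'a set" and w :: "'a \<Rightarrow> 'a \<Rightarrow> real" +
  fixes \<gamma> :: real
  assumes gap_pos: "0 < \<gamma>"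
    and gap: "\<And>f. \<gamma> * variance f \<le> dirichlet_form f"
begin

lemma rayleigh_quotients_ge_gap:
  assumes "q \<in> rayleigh_quotients A"
  shows "\<gamma> \<le> q"
proof -
  obtain f where f: "\<forall>x\<in>V. 0 \<le> f x" "\<not> f constant_on V"
    and q: "q = inner_pi V w (laplacian V w f) f / ((norm_pi V w 2 f)\<^sup>2 - (norm_pi V w 1 f)\<^sup>2)"
    using assms unfolding rayleigh_quotients_def by blast
  have "q = dirichlet_form f / variance f"
    unfolding q using f(1) by (simp add: norm_pi_diff_eq_variance inner_pi_laplacian)
  then show ?thesis
    using gap[of f] variance_pos[OF f(2)] by (simp add: pos_le_divide_eq)
qed

lemma set_eigenvalue_ge_gap:
  assumes "A \<subseteq> V" "A \<noteq> {}"
  shows "\<gamma> \<le> set_eigenvalue V w A"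
  unfolding set_eigenvalue_def rayleigh_quotients_def[symmetric]
proof (rule cInf_greatest)
  obtain x where x: "x \<in> A"
    using assms by blast
  have "V \<noteq> {x}"
    using card_V by auto
  then show "rayleigh_quotients A \<noteq> {}"
    using indicator_quotient[of "{x}" A] x assms by blast
qed (rule rayleigh_quotients_ge_gap)

lemma set_eigenvalue_le:
  assumes A: "A \<subseteq> V" "A \<noteq> {}" "A \<noteq> V"
    and le: "dirichlet_form (indicator A) \<le> c * variance (indicator A)"
  shows "set_eigenvalue V w A \<le> c"
proof -
  let ?f = "indicator A :: 'a \<Rightarrow> real"
  have "set_eigenvalue V w A \<le> dirichlet_form ?f / variance ?f"
    unfolding set_eigenvalue_def rayleigh_quotients_def[symmetric]
    using rayleigh_quotients_ge_gap
    by (intro cInf_lower indicator_quotient subset_refl A bdd_belowI[of _ \<gamma>])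
  also have "\<dots> \<le> c"
    using le variance_pos[OF indicator_not_constant[OF A]] by (simp add: pos_divide_le_eq)
  finally show ?thesis .
qed

lemma profile_family:
  fixes r :: real
  defines "F \<equiv> {set_eigenvalue V w A | A. A \<subseteq> V \<and> 0 < stationary_set V w A \<and> stationary_set V w A \<le> r}"
  shows profile_family_ge_gap: "\<And>y. y \<in> F \<Longrightarrow> \<gamma> \<le> y"
    and profile_family_nonempty: "1 / card V \<le> r \<Longrightarrow> F \<noteq> {}"
proof -
  fix y assume "y \<in> F"
  then obtain A where "y = set_eigenvalue V w A" "A \<subseteq> V" "0 < stationary_set V w A"
    unfolding F_def by blast
  then show "\<gamma> \<le> y"
    using set_eigenvalue_ge_gap[of A] by (cases "A = {}") (auto simp: stationary_set_def)
next
  assume "1 / card V \<le> r"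
  moreover obtain x where "x \<in> V"
    using card_pos by fastforce
  ultimately show "F \<noteq> {}"
    using card_pos unfolding F_def
    by (auto simp: stationary_set_eq intro!: exI[of _ "{x}"])
qed

lemma spectral_profile_ge_gap: "1 / card V \<le> r \<Longrightarrow> \<gamma> \<le> spectral_profile V w r"
  unfolding spectral_profile_def
  by (intro cInf_greatest profile_family_nonempty profile_family_ge_gap)

lemma spectral_profile_le:
  assumes "A \<subseteq> V" "A \<noteq> {}" "card A / card V \<le> r"
  shows "spectral_profile V w r \<le> set_eigenvalue V w A"
  unfolding spectral_profile_def
proof (rule cInf_lower)
  have "0 < card A"
    using assms finite_V by (simp add: card_gt_0_iff finite_subset)
  then show "set_eigenvalue V w A \<in>
      {set_eigenvalue V w A | A. A \<subseteq> V \<and> 0 < stationary_set V w A \<and> stationary_set V w A \<le> r}"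
    using assms card_pos by (auto simp: stationary_set_eq intro!: exI[of _ A])
next
  show "bdd_below {set_eigenvalue V w A | A. A \<subseteq> V \<and> 0 < stationary_set V w A \<and> stationary_set V w A \<le> r}"
    by (intro bdd_belowI[of _ \<gamma>] profile_family_ge_gap)
qed

lemma spectral_profile_antimono:
  assumes "1 / card V \<le> r" "r \<le> s"
  shows "spectral_profile V w s \<le> spectral_profile V w r"
  unfolding spectral_profile_def
proof (rule cInf_superset_mono)
  show "bdd_below {set_eigenvalue V w A | A. A \<subseteq> V \<and> 0 < stationary_set V w A \<and> stationary_set V w A \<le> s}"
    by (intro bdd_belowI[of _ \<gamma>] profile_family_ge_gap)
qed (use assms(2) profile_family_nonempty[OF assms(1)] in force)+

lemma profile_integrand_nonneg:
  assumes "1 / card V \<le> r"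
  shows "0 \<le> 2 / (r * spectral_profile V w r)"
proof -
  have "0 < 1 / real (card V)"
    using card_pos by simp
  then have "0 \<le> r" "0 \<le> spectral_profile V w r"
    using assms spectral_profile_ge_gap[OF assms] gap_pos by linarith+
  then show ?thesis
    by simp
qed

text \<open>
  The integrand is the product of the increasing function \<open>1 / \<Lambda>\<close> and a continuous one, which is the
  situation of the second mean value theorem; existence of the integral matters, as a
  non-integrable function would have the integral \<open>0\<close>.
\<close>

lemma profile_integrand_integrable:
  assumes a: "1 / card V \<le> a"
  shows "(\<lambda>r. 2 / (r * spectral_profile V w r)) integrable_on {a..b}"
proof -
  have "0 < 1 / real (card V)"
    using card_pos by simp
  then have a0: "0 < a"
    using a by linarith
  show ?thesis
  proof (cases "a \<le> b")
    case True
    have "(\<lambda>r. 2 / r) integrable_on {a..b}"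
      using a0 by (intro integrable_continuous_real continuous_intros) auto
    moreover have "1 / spectral_profile V w r \<le> 1 / spectral_profile V w s"
      if "a \<le> r" "r \<le> s" "s \<le> b" for r s
      using that a gap_pos spectral_profile_ge_gap[of s] spectral_profile_antimono[of r s]
      by (intro divide_left_mono) auto
    ultimately obtain I where "((\<lambda>r. 1 / spectral_profile V w r * (2 / r)) has_integral I) {a..b}"
      using True by (elim second_mean_value_theorem_full[where g = "\<lambda>r. 1 / spectral_profile V w r"])
    then show ?thesis
      by (auto simp: integrable_on_def mult.commute)
  qed auto
qed

text \<open>
  Since \<open>\<Lambda>\<close> decreases, a bound at the left end of an interval holds throughout.
\<close>

lemma profile_integral_segment_ge:
  assumes a: "1 / card V \<le> a" and ab: "a \<le> b"
    and bound: "spectral_profile V w a \<le> c"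
  shows "2 / c * (ln b - ln a) \<le> integral {a..b} (\<lambda>r. 2 / (r * spectral_profile V w r))"
proof -
  have "0 < 1 / real (card V)"
    using card_pos by simp
  then have a0: "0 < a"
    using a by linarith
  have "c \<noteq> 0"
    using gap_pos spectral_profile_ge_gap[OF a] bound by linarith
  then have "((\<lambda>r. 2 / c * (1 / r)) has_integral (2 / c * ln b - 2 / c * ln a)) {a..b}"
    using ab a0
    by (intro fundamental_theorem_of_calculus)
      (auto intro!: derivative_eq_intros simp: has_real_derivative_iff_has_vector_derivative[symmetric])
  then have "((\<lambda>r. 2 / c * (1 / r)) has_integral (2 / c * (ln b - ln a))) {a..b}"
    by (simp add: right_diff_distrib)
  then show ?thesis
  proof (rule has_integral_le[OF _ integrable_integral])
    fix r assume r: "r \<in> {a..b}"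
    have "0 < spectral_profile V w r" "spectral_profile V w r \<le> c"
      using r a bound gap_pos spectral_profile_ge_gap[of r] spectral_profile_antimono[of a r] by auto
    then show "2 / c * (1 / r) \<le> 2 / (r * spectral_profile V w r)"
      using r a0 by (simp add: field_simps)
  qed (use a in \<open>rule profile_integrand_integrable\<close>)
qed

end

section \<open>Averaging over blocks of consecutive integers\<close>

definition block_kernel :: "nat \<Rightarrow> nat \<Rightarrow> nat \<Rightarrow> real" where
  "block_kernel b x y = (if x div b = y div b then 1 / real b else 0)"

lemma block_kernel_nonneg: "0 \<le> block_kernel b x y"
  by (simp add: block_kernel_def)

lemma block_kernel_sym: "block_kernel b x y = block_kernel b y x"
  by (simp add: block_kernel_def eq_commute)

lemma block_kernel_1: "block_kernel 1 x y = (if x = y then 1 else 0)"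
  by (simp add: block_kernel_def)

lemma block_kernel_full: "x < b \<Longrightarrow> y < b \<Longrightarrow> block_kernel b x y = 1 / b"
  by (simp add: block_kernel_def)

lemma sum_block_kernel:
  assumes "b dvd m" "x < m"
  shows "(\<Sum>y<m. block_kernel b x y) = 1"
proof -
  obtain d where d: "m = b * d"
    using assms(1) by blast
  then have b: "0 < b"
    using assms(2) by (cases b) auto
  have "x div b < d"
    using assms(2) unfolding d by (simp add: less_mult_imp_div_less mult.commute)
  then have "b * (x div b) + b \<le> m"
    unfolding d by (metis Suc_leI add.commute mult_Suc_right mult_le_mono2)
  then have "{y \<in> {..<m}. x div b = y div b} = {b * (x div b)..<b + b * (x div b)}"
    using b by (auto simp: dividend_less_times_div intro!: div_nat_eqI[symmetric])
  then have "card {y \<in> {..<m}. x div b = y div b} = b"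
    by simp
  moreover have "(\<Sum>y<m. block_kernel b x y) = card {y \<in> {..<m}. x div b = y div b} / b"
    unfolding block_kernel_def by (subst sum.inter_filter[symmetric]) auto
  ultimately show ?thesis
    using b by simp
qed

text \<open>
  When \<open>b\<close> divides \<open>c\<close>, a step inside a \<open>b\<close>-block stays in the same \<open>c\<close>-block, so it does not change the
  \<open>c\<close>-average. With the primed version below this says that the averages commute and the coarser one absorbs the finer one.
\<close>

lemma block_kernel_compose:
  assumes "b dvd c" "c dvd m" "x < m"
  shows "(\<Sum>z<m. block_kernel b x z * block_kernel c z y) = block_kernel c x y"
proof -
  obtain d where d: "c = b * d"
    using assms(1) by blast
  have "(\<Sum>z<m. block_kernel b x z * block_kernel c z y)
      = (\<Sum>z<m. block_kernel b x z * block_kernel c x y)"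
    by (intro sum.cong refl) (auto simp: block_kernel_def d div_mult2_eq)
  also have "\<dots> = block_kernel c x y"
    using assms by (simp add: sum_distrib_right[symmetric] sum_block_kernel[OF dvd_trans])
  finally show ?thesis .
qed

lemma block_kernel_compose':
  assumes "b dvd c" "c dvd m" "y < m"
  shows "(\<Sum>z<m. block_kernel c x z * block_kernel b z y) = block_kernel c x y"
proof -
  have "block_kernel c x z * block_kernel b z y = block_kernel b y z * block_kernel c z x" for z
    by (metis block_kernel_sym mult.commute)
  then show ?thesis
    using block_kernel_compose[OF assms, of x] by (metis (mono_tags, lifting) block_kernel_sym sum.cong)
qed

text \<open>
  Averaging is a contraction of \<open>L\<^sup>2\<close>; here by \<open>2 a b \<le> a\<^sup>2 + b\<^sup>2\<close> and the fact that rows and columns sum to \<open>1\<close>.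
\<close>

lemma block_kernel_quadratic_le:
  assumes "b dvd m"
  shows "(\<Sum>x<m. \<Sum>y<m. block_kernel b x y * (f x * f y)) \<le> (\<Sum>x<m. (f x)\<^sup>2)"
proof -
  let ?E = "block_kernel b"
  have "(\<Sum>x<m. \<Sum>y<m. ?E x y * (f x * f y))
      \<le> (\<Sum>x<m. \<Sum>y<m. ?E x y * (f x)\<^sup>2 / 2 + ?E x y * (f y)\<^sup>2 / 2)"
  proof (intro sum_mono)
    fix x y
    have "0 \<le> ?E x y * (f x - f y)\<^sup>2"
      by (simp add: block_kernel_nonneg)
    then show "?E x y * (f x * f y) \<le> ?E x y * (f x)\<^sup>2 / 2 + ?E x y * (f y)\<^sup>2 / 2"
      by (simp add: power2_eq_square algebra_simps)
  qed
  also have "\<dots> = (\<Sum>x<m. \<Sum>y<m. ?E x y * (f x)\<^sup>2) / 2 + (\<Sum>x<m. \<Sum>y<m. ?E x y * (f y)\<^sup>2) / 2"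
    by (simp add: sum.distrib sum_divide_distrib)
  also have "(\<Sum>x<m. \<Sum>y<m. ?E x y * (f y)\<^sup>2) = (\<Sum>x<m. \<Sum>y<m. ?E x y * (f x)\<^sup>2)"
    by (subst sum.swap) (simp add: block_kernel_sym)
  also have "(\<Sum>x<m. \<Sum>y<m. ?E x y * (f x)\<^sup>2) = (\<Sum>x<m. (f x)\<^sup>2)"
    by (simp add: sum_distrib_right[symmetric] sum_block_kernel[OF assms])
  finally show ?thesis
    by simp
qed

lemma sum_mult_indicator_square:
  fixes g :: "nat \<Rightarrow> nat \<Rightarrow> real"
  assumes "s \<le> m"
  shows "(\<Sum>x<m. \<Sum>y<m. g x y * (indicator {..<s} x * indicator {..<s} y)) = (\<Sum>x<s. \<Sum>y<s. g x y)"
proof -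
  have "(\<Sum>y<m. g x y * (indicator {..<s} x * indicator {..<s} y))
      = indicator {..<s} x * (\<Sum>y<s. g x y)" for x
  proof -
    have "(\<Sum>y<m. g x y * (indicator {..<s} x * indicator {..<s} y))
        = (\<Sum>y<s. indicator {..<s} x * g x y)"
      using assms by (intro sum.mono_neutral_cong_right) auto
    then show ?thesis
      by (simp add: sum_distrib_left)
  qed
  moreover have "(\<Sum>x<m. indicator {..<s} x * (\<Sum>y<s. g x y)) = (\<Sum>x<s. \<Sum>y<s. g x y)"
    using assms by (intro sum.mono_neutral_cong_right) auto
  ultimately show ?thesis
    by simp
qed

lemma block_kernel_indicator_large:
  assumes "s dvd b" "0 < b" "s \<le> m"
  shows "(\<Sum>x<m. \<Sum>y<m. block_kernel b x y * (indicator {..<s} x * indicator {..<s} y)) = real s ^ 2 / b"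
proof -
  have sb: "s \<le> b"
    using assms by (simp add: dvd_imp_le)
  have "(\<Sum>x<s. \<Sum>y<s. block_kernel b x y) = (\<Sum>x<s. \<Sum>y<s. 1 / b)"
    using sb by (intro sum.cong refl block_kernel_full) auto
  then show ?thesis
    by (simp add: sum_mult_indicator_square[OF assms(3)] power2_eq_square)
qed

lemma block_kernel_indicator_small:
  assumes "b dvd s" "s \<le> m"
  shows "(\<Sum>x<m. \<Sum>y<m. block_kernel b x y * (indicator {..<s} x * indicator {..<s} y)) = real s"
  by (simp add: sum_mult_indicator_square[OF assms(2)] sum_block_kernel[OF assms(1)])

section \<open>The hierarchical graph\<close>

definition num_blocks :: "nat \<Rightarrow> nat" where
  "num_blocks j = 2 ^ (2 ^ j - 1)"

definition block_size :: "nat \<Rightarrow> nat \<Rightarrow> nat" where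
  "block_size k j = 2 ^ (2 ^ k - 2 ^ j)"

abbreviation level_kernel :: "nat \<Rightarrow> nat \<Rightarrow> nat \<Rightarrow> nat \<Rightarrow> real" where
  "level_kernel k j \<equiv> block_kernel (block_size k j)"

definition hier_weight :: "nat \<Rightarrow> nat \<Rightarrow> nat \<Rightarrow> real" where
  "hier_weight k x y = (level_kernel k k x y + (\<Sum>j<k. 2 ^ j * level_kernel k j x y)) / 2 ^ k"

text \<open>
  The eigenvalue of the Laplacian on the functions that are constant on the blocks of level \<open>j\<close> and, for \<open>j > 0\<close>,
  have mean zero on the blocks of level \<open>j - 1\<close>.
\<close>

definition level_eigenvalue :: "nat \<Rightarrow> nat \<Rightarrow> real" where
  "level_eigenvalue k j = (2 ^ j - 1) / 2 ^ k"

lemma num_blocks_pos: "0 < num_blocks j"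
  by (simp add: num_blocks_def)

lemma num_blocks_0: "num_blocks 0 = 1"
  by (simp add: num_blocks_def)

lemma num_blocks_Suc: "num_blocks (Suc j) = num_blocks j * 2 ^ (2 ^ j)"
proof -
  have "(2::nat) ^ Suc j - 1 = (2 ^ j - 1) + 2 ^ j"
    by simp
  then show ?thesis
    unfolding num_blocks_def by (metis power_add)
qed

lemma num_blocks_mono: "i \<le> j \<Longrightarrow> num_blocks i \<le> num_blocks j"
  by (simp add: num_blocks_def diff_le_mono)

lemma block_size_pos: "0 < block_size k j"
  by (simp add: block_size_def)

lemma block_size_top: "block_size k k = 1"
  by (simp add: block_size_def)

lemma block_size_0: "block_size k 0 = num_blocks k"
  by (simp add: block_size_def num_blocks_def)

lemma block_size_dvd: "i \<le> j \<Longrightarrow> block_size k j dvd block_size k i"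
  by (simp add: block_size_def le_imp_power_dvd diff_le_mono2)

lemma block_size_dvd_num_blocks: "block_size k j dvd num_blocks k"
  using block_size_dvd[of 0 j k] by (simp add: block_size_0)

lemma block_size_le_num_blocks: "block_size k j \<le> num_blocks k"
  by (simp add: block_size_dvd_num_blocks dvd_imp_le num_blocks_pos)

lemma block_size_times_num_blocks:
  assumes "j \<le> k"
  shows "block_size k j * num_blocks j = num_blocks k"
proof -
  have "(2::nat) ^ j \<le> 2 ^ k" "(1::nat) \<le> 2 ^ j"
    using assms by simp_all
  then have "(2::nat) ^ k - 2 ^ j + (2 ^ j - 1) = 2 ^ k - 1"
    by linarith
  then show ?thesis
    unfolding block_size_def num_blocks_def by (metis power_add)
qed

lemma sum_two_powers: "(\<Sum>j<k. 2 ^ j) = (2 ^ k - 1 :: real)"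
  by (induction k) auto

lemma sum_two_powers_above:
  assumes "i < k"
  shows "(\<Sum>j<k. if i < j then 2 ^ j else 0) = (2 ^ k - 2 ^ Suc i :: real)"
proof -
  from assms have "Suc i \<le> k"
    by simp
  then show ?thesis
  proof (induction k rule: dec_induct)
    case base
    then show ?case
      by (simp add: sum.neutral)
  next
    case (step k)
    then show ?case
      by simp
  qed
qed

lemma level_kernel_compose:
  assumes "x < num_blocks k" "y < num_blocks k"
  shows "(\<Sum>z<num_blocks k. level_kernel k j x z * level_kernel k i z y) = level_kernel k (min i j) x y"
  using block_kernel_compose[OF block_size_dvd block_size_dvd_num_blocks assms(1), of i j]
    block_kernel_compose'[OF block_size_dvd block_size_dvd_num_blocks assms(2), of j i]
  by (cases "i \<le> j") (auto simp: min_def)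

lemma sum_level_kernel: "x < num_blocks k \<Longrightarrow> (\<Sum>y<num_blocks k. level_kernel k j x y) = 1"
  by (rule sum_block_kernel[OF block_size_dvd_num_blocks])

text \<open>
  Row sums, the action on \<open>level_increment\<close> and the Dirichlet form are all obtained by
  moving a sum over \<open>z\<close> inside the sum over the levels.
\<close>

lemma hier_weight_apply:
  assumes "finite V"
  shows "(\<Sum>z\<in>V. hier_weight k x z * f z)
    = ((\<Sum>z\<in>V. level_kernel k k x z * f z)
        + (\<Sum>j<k. 2 ^ j * (\<Sum>z\<in>V. level_kernel k j x z * f z))) / 2 ^ k"
proof -
  have "(\<Sum>z\<in>V. hier_weight k x z * f z)
      = (\<Sum>z\<in>V. level_kernel k k x z * f z + (\<Sum>j<k. 2 ^ j * (level_kernel k j x z * f z))) / 2 ^ k"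
    unfolding hier_weight_def sum_divide_distrib
    by (intro sum.cong refl) (simp add: distrib_right sum_distrib_right mult.assoc)
  also have "(\<Sum>z\<in>V. \<Sum>j<k. 2 ^ j * (level_kernel k j x z * f z))
      = (\<Sum>j<k. 2 ^ j * (\<Sum>z\<in>V. level_kernel k j x z * f z))"
    by (subst sum.swap) (simp add: sum_distrib_left)
  then have "(\<Sum>z\<in>V. level_kernel k k x z * f z + (\<Sum>j<k. 2 ^ j * (level_kernel k j x z * f z)))
      = (\<Sum>z\<in>V. level_kernel k k x z * f z) + (\<Sum>j<k. 2 ^ j * (\<Sum>z\<in>V. level_kernel k j x z * f z))"
    by (simp add: sum.distrib)
  finally show ?thesis .
qed

lemma hier_weight_row_sum:
  assumes "x < num_blocks k"
  shows "(\<Sum>y<num_blocks k. hier_weight k x y) = 1"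
  using hier_weight_apply[of "{..<num_blocks k}" k x "\<lambda>_. 1"]
  by (simp add: sum_level_kernel[OF assms] sum_two_powers)

lemma hier_weight_pos:
  assumes "0 < k" "x < num_blocks k" "y < num_blocks k"
  shows "0 < hier_weight k x y"
proof -
  have "0 < level_kernel k 0 x y"
    using assms num_blocks_pos[of k] by (simp add: block_size_0 block_kernel_full)
  then have "0 < (\<Sum>j<k. 2 ^ j * level_kernel k j x y)"
    using assms(1) by (intro sum_pos2[of _ 0]) (auto simp: block_kernel_nonneg)
  then show ?thesis
    unfolding hier_weight_def
    by (intro divide_pos_pos add_nonneg_pos) (auto simp: block_kernel_nonneg)
qed

lemma hier_weight_sym: "hier_weight k x y = hier_weight k y x"
  unfolding hier_weight_def by (simp add: block_kernel_sym[of _ x y])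

lemma num_blocks_ge_2:
  assumes "0 < k"
  shows "2 \<le> num_blocks k"
  using num_blocks_mono[of 1 k] assms by (simp add: num_blocks_def)

lemma hier_unit_weight_graph:
  assumes "0 < k"
  shows "unit_weight_graph {..<num_blocks k} (hier_weight k)"
proof
  show "2 \<le> card {..<num_blocks k}"
    using num_blocks_ge_2[OF assms] by simp
qed (auto simp: hier_weight_row_sum hier_weight_sym intro!: less_imp_le[OF hier_weight_pos] assms)

subsection \<open>Mixing time\<close>

text \<open>
  The kernel of the spectral projection of the walk for \<open>level_eigenvalue k (Suc i)\<close>.
\<close>

definition level_increment :: "nat \<Rightarrow> nat \<Rightarrow> nat \<Rightarrow> nat \<Rightarrow> real" where
  "level_increment k i x y = level_kernel k (Suc i) x y - level_kernel k i x y"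

text \<open>
  Averages over levels up to \<open>i\<close> annihilate the increment and those over higher levels fix it, so the
  walk multiplies it by the total rate \<open>(1 + \<Sum>j\<in>{i<..<k}. 2 ^ j) / 2 ^ k\<close> of the latter.
\<close>

lemma hier_weight_level_increment:
  assumes "i < k" "x < num_blocks k" "y < num_blocks k"
  shows "(\<Sum>z<num_blocks k. hier_weight k x z * level_increment k i z y)
    = (1 - level_eigenvalue k (Suc i)) * level_increment k i x y"
proof -
  have level: "(\<Sum>z<num_blocks k. level_kernel k j x z * level_increment k i z y)
      = (if i < j then level_increment k i x y else 0)" for j
  proof -
    have "(\<Sum>z<num_blocks k. level_kernel k j x z * level_increment k i z y)
        = level_kernel k (min (Suc i) j) x y - level_kernel k (min i j) x y"
      unfolding level_increment_def right_diff_distrib sum_subtractf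
      by (simp only: level_kernel_compose[OF assms(2,3)])
    then show ?thesis
      by (auto simp: level_increment_def min_def)
  qed
  have "(\<Sum>j<k. 2 ^ j * (if i < j then level_increment k i x y else 0))
      = (\<Sum>j<k. if i < j then 2 ^ j else 0) * level_increment k i x y"
    unfolding sum_distrib_right by (intro sum.cong refl) auto
  then have "(\<Sum>z<num_blocks k. hier_weight k x z * level_increment k i z y)
      = (1 + (2 ^ k - 2 ^ Suc i)) * level_increment k i x y / 2 ^ k"
    unfolding hier_weight_apply[OF finite_lessThan] level sum_two_powers_above[OF assms(1)]
    using assms(1) by (simp add: algebra_simps)
  then show ?thesis
    by (simp add: level_eigenvalue_def field_simps)
qed

text \<open>
  The spectral decomposition of the powers of the walk. At power \<open>0\<close> the increments telescope from the
  uniform kernel to the identity.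
\<close>

lemma hier_transition_pow:
  assumes k: "0 < k" and x: "x < num_blocks k" and y: "y < num_blocks k"
  shows "transition_pow {..<num_blocks k} (hier_weight k) n x y
    = 1 / num_blocks k + (\<Sum>i<k. (1 - level_eigenvalue k (Suc i)) ^ n * level_increment k i x y)"
  using x
proof (induction n arbitrary: x)
  case 0
  have "(\<Sum>i<k. level_increment k i x y) = level_kernel k k x y - level_kernel k 0 x y"
    unfolding level_increment_def by (rule sum_lessThan_telescope)
  also have "\<dots> = (if x = y then 1 else 0) - 1 / num_blocks k"
    using 0 y by (simp add: block_size_top block_kernel_1[simplified] block_size_0 block_kernel_full)
  finally show ?case
    by simp
next
  case (Suc n)
  interpret unit_weight_graph "{..<num_blocks k}" "hier_weight k"
    using k by (rule hier_unit_weight_graph)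
  let ?w = "hier_weight k" and ?\<theta> = "\<lambda>i. 1 - level_eigenvalue k (Suc i)" and ?N = "num_blocks k"
  have "transition_pow {..<?N} ?w (Suc n) x y
      = (\<Sum>z<?N. ?w x z * (1 / ?N + (\<Sum>i<k. ?\<theta> i ^ n * level_increment k i z y)))"
    using Suc by (simp add: transition_eq)
  also have "\<dots> = (\<Sum>z<?N. ?w x z) / ?N
      + (\<Sum>z<?N. \<Sum>i<k. ?\<theta> i ^ n * (?w x z * level_increment k i z y))"
    by (simp add: distrib_left sum.distrib sum_distrib_left sum_divide_distrib mult.left_commute)
  also have "(\<Sum>z<?N. \<Sum>i<k. ?\<theta> i ^ n * (?w x z * level_increment k i z y))
      = (\<Sum>i<k. ?\<theta> i ^ n * (\<Sum>z<?N. ?w x z * level_increment k i z y))"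
    by (subst sum.swap) (simp add: sum_distrib_left)
  also have "\<dots> = (\<Sum>i<k. ?\<theta> i ^ Suc n * level_increment k i x y)"
    using Suc.prems y by (intro sum.cong refl) (simp add: hier_weight_level_increment)
  finally show ?case
    using Suc.prems by (simp only: hier_weight_row_sum)
qed

lemma hier_heat_kernel:
  assumes "0 < k" "x < num_blocks k" "y < num_blocks k"
  shows "heat_kernel {..<num_blocks k} (hier_weight k) t x y
    = 1 / num_blocks k + (\<Sum>i<k. exp (- t * level_eigenvalue k (Suc i)) * level_increment k i x y)"
proof -
  let ?\<theta> = "\<lambda>i. 1 - level_eigenvalue k (Suc i)" and ?N = "num_blocks k"
  have exp_sums: "(\<lambda>n. t ^ n / fact n * (c ^ n * d)) sums (exp (t * c) * d)" for c d :: real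
    using sums_mult2[OF exp_converges[of "t * c"], of d]
    by (simp add: power_mult_distrib field_simps)
  have "(\<lambda>n. t ^ n / fact n * (1 ^ n * (1 / ?N))
        + (\<Sum>i<k. t ^ n / fact n * (?\<theta> i ^ n * level_increment k i x y)))
      sums (exp (t * 1) * (1 / ?N) + (\<Sum>i<k. exp (t * ?\<theta> i) * level_increment k i x y))"
    by (intro sums_add sums_sum exp_sums)
  then have "(\<lambda>n. t ^ n / fact n * transition_pow {..<?N} (hier_weight k) n x y)
      sums (exp t / ?N + (\<Sum>i<k. exp (t * ?\<theta> i) * level_increment k i x y))"
    by (simp add: hier_transition_pow[OF assms] distrib_left sum_distrib_left)
  then have "heat_kernel {..<?N} (hier_weight k) t x y
      = exp (- t) * (exp t / ?N + (\<Sum>i<k. exp (t * ?\<theta> i) * level_increment k i x y))"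
    unfolding heat_kernel_def by (simp add: sums_unique[symmetric])
  also have "\<dots> = exp (- t) * exp t / ?N
      + (\<Sum>i<k. exp (- t) * exp (t * ?\<theta> i) * level_increment k i x y)"
    by (simp add: distrib_left sum_distrib_left mult.assoc)
  also have "\<dots> = 1 / ?N + (\<Sum>i<k. exp (- t * level_eigenvalue k (Suc i)) * level_increment k i x y)"
    unfolding mult_exp_exp by (simp add: algebra_simps)
  finally show ?thesis .
qed

text \<open>
  Both kernels in the increment take values between \<open>0\<close> and the reciprocal of the finer block size.
\<close>

lemma level_increment_bound:
  assumes "i < k"
  shows "\<bar>num_blocks k * level_increment k i x y\<bar> \<le> num_blocks (Suc i)"
proof -
  let ?s = "block_size k (Suc i)"
  have kernel: "0 \<le> level_kernel k j x y \<and> level_kernel k j x y \<le> 1 / ?s" if "j \<le> Suc i" for j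
  proof -
    have "?s \<le> block_size k j"
      using that by (simp add: block_size_dvd dvd_imp_le block_size_pos)
    then show ?thesis
      using block_size_pos[of k "Suc i"] by (simp add: block_kernel_def frac_le)
  qed
  have "\<bar>level_increment k i x y\<bar> \<le> 1 / ?s"
    unfolding level_increment_def using kernel[of i] kernel[of "Suc i"] by auto
  moreover have "real (num_blocks k) = real ?s * real (num_blocks (Suc i))"
    using block_size_times_num_blocks[of "Suc i" k] assms by (metis Suc_leI of_nat_mult)
  ultimately show ?thesis
    using block_size_pos[of k "Suc i"] num_blocks_pos[of "Suc i"]
    by (simp add: abs_mult field_simps)
qed

lemma exp_2_ge_6: "6 \<le> exp (2 :: real)"
proof -
  have "5 / 2 \<le> exp (1 :: real)"
    using abs_le_D2[OF e_approx_32] by simp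
  then have "(5 / 2) ^ 2 \<le> exp (1 :: real) ^ 2"
    by (intro power_mono) auto
  then show ?thesis
    by (simp add: power2_eq_square flip: exp_add)
qed

text \<open>
  The one estimate that uses the choice of the block numbers: with \<open>m = 2 ^ Suc i - 1\<close>, there are \<open>2 ^ m\<close> blocks and
  the eigenvalue is \<open>m / 2 ^ k\<close>, so at time \<open>2 * 2 ^ k\<close> the growth \<open>2 ^ m\<close> is beaten by the decay \<open>exp (- 2 m)\<close>.
\<close>

lemma level_decay:
  "num_blocks (Suc i) * exp (- (2 * 2 ^ k) * level_eigenvalue k (Suc i)) \<le> (1 / 3 :: real) ^ Suc i"
proof -
  define m :: nat where "m = 2 ^ Suc i - 1"
  have m: "real m = 2 ^ Suc i - 1"
    by (simp add: m_def of_nat_diff)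
  have "num_blocks (Suc i) * exp (- (2 * 2 ^ k) * level_eigenvalue k (Suc i))
      = 2 ^ m * exp (- 2 * real m)"
    by (simp add: num_blocks_def level_eigenvalue_def m m_def)
  also have "exp (- 2 * real m) = (1 / exp 2) ^ m"
    by (simp add: exp_minus exp_of_nat2_mult inverse_eq_divide power_one_over)
  also have "2 ^ m * (1 / exp 2) ^ m = (2 / exp 2 :: real) ^ m"
    by (simp add: power_divide)
  also have "\<dots> \<le> (1 / 3) ^ m"
    using exp_2_ge_6 by (intro power_mono) (auto simp: field_simps)
  also have "\<dots> \<le> (1 / 3) ^ Suc i"
    unfolding m_def using less_exp[of "Suc i"] by (intro power_decreasing) auto
  finally show ?thesis .
qed

lemma hier_mixing_time_le:
  assumes "0 < k"
  shows "mixing_time {..<num_blocks k} (hier_weight k) \<le> 2 * 2 ^ k"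
proof -
  interpret unit_weight_graph "{..<num_blocks k}" "hier_weight k"
    using assms by (rule hier_unit_weight_graph)
  have geometric: "(\<Sum>i<k. (1 / 3) ^ Suc i) \<le> (1 / 2 :: real)"
  proof -
    have "(\<Sum>i<k. (1 / 3) ^ Suc i) = (1 - (1 / 3) ^ k) / (2 :: real)"
      by (induction k) (simp_all add: algebra_simps)
    then show ?thesis
      by simp
  qed
  show ?thesis
  proof (rule mixing_time_le)
    fix x y assume xy: "x \<in> {..<num_blocks k}" "y \<in> {..<num_blocks k}"
    let ?e = "\<lambda>i. exp (- (2 * 2 ^ k) * level_eigenvalue k (Suc i))"
    have "card {..<num_blocks k} * heat_kernel {..<num_blocks k} (hier_weight k) (2 * 2 ^ k) x y - 1
        = (\<Sum>i<k. ?e i * (num_blocks k * level_increment k i x y))"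
      using xy assms num_blocks_pos[of k]
      by (simp add: hier_heat_kernel distrib_left sum_distrib_left mult.left_commute)
    also have "\<bar>\<dots>\<bar> \<le> (\<Sum>i<k. (1 / 3) ^ Suc i)"
    proof (rule order_trans[OF sum_abs sum_mono])
      fix i assume "i \<in> {..<k}"
      then have "\<bar>?e i * (num_blocks k * level_increment k i x y)\<bar> \<le> ?e i * num_blocks (Suc i)"
        using level_increment_bound[of i k x y] unfolding abs_mult[of "?e i"]
        by (intro mult_mono) auto
      also have "\<dots> \<le> (1 / 3) ^ Suc i"
        using level_decay[of i k] by (simp only: mult.commute)
      finally show "\<bar>?e i * (num_blocks k * level_increment k i x y)\<bar> \<le> (1 / 3) ^ Suc i" .
    qed
    finally show "\<bar>card {..<num_blocks k} * heat_kernel {..<num_blocks k} (hier_weight k) (2 * 2 ^ k) x y - 1\<bar> \<le> 1 / 2"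
      using geometric by linarith
  qed simp
qed

subsection \<open>Spectral profile\<close>

text \<open>
  The rates of all levels add up to \<open>1\<close> and level \<open>k\<close> contributes nothing, so the Dirichlet form is the
  weighted sum of those of the levels below \<open>k\<close>.
\<close>

lemma hier_dirichlet_form:
  assumes "0 < k"
  shows "unit_weight_graph.dirichlet_form {..<num_blocks k} (hier_weight k) f
    = (\<Sum>i<k. 2 ^ i * ((\<Sum>x<num_blocks k. (f x)\<^sup>2)
        - (\<Sum>x<num_blocks k. \<Sum>y<num_blocks k. level_kernel k i x y * (f x * f y)))) / 2 ^ k / num_blocks k"
proof -
  interpret unit_weight_graph "{..<num_blocks k}" "hier_weight k"
    using assms by (rule hier_unit_weight_graph)
  let ?N = "num_blocks k"
  let ?S = "\<Sum>x<?N. (f x)\<^sup>2"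
  let ?Q = "\<lambda>i. \<Sum>x<?N. \<Sum>y<?N. level_kernel k i x y * (f x * f y)"
  have top: "?Q k = ?S"
    by (simp add: block_size_top block_kernel_1[simplified] power2_eq_square if_distrib[of "\<lambda>c. c * _"] cong: if_cong)
  have "(\<Sum>x<?N. \<Sum>y<?N. hier_weight k x y * (f x * f y))
      = (\<Sum>x<?N. (\<Sum>y<?N. level_kernel k k x y * (f x * f y))
          + (\<Sum>j<k. 2 ^ j * (\<Sum>y<?N. level_kernel k j x y * (f x * f y)))) / 2 ^ k"
    unfolding hier_weight_apply[OF finite_lessThan] sum_divide_distrib ..
  also have "\<dots> = (?Q k + (\<Sum>x<?N. \<Sum>j<k. 2 ^ j * (\<Sum>y<?N. level_kernel k j x y * (f x * f y)))) / 2 ^ k"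
    by (simp only: sum.distrib)
  also have "(\<Sum>x<?N. \<Sum>j<k. 2 ^ j * (\<Sum>y<?N. level_kernel k j x y * (f x * f y))) = (\<Sum>j<k. 2 ^ j * ?Q j)"
    by (subst sum.swap) (simp only: sum_distrib_left)
  finally have "(\<Sum>x<?N. \<Sum>y<?N. hier_weight k x y * (f x * f y)) = (?S + (\<Sum>j<k. 2 ^ j * ?Q j)) / 2 ^ k"
    by (simp only: top)
  moreover have "(\<Sum>j<k. 2 ^ j * (?S - ?Q j)) = (2 ^ k - 1) * ?S - (\<Sum>j<k. 2 ^ j * ?Q j)"
    unfolding right_diff_distrib sum_subtractf sum_two_powers[symmetric] sum_distrib_right ..
  moreover have "S - X = Y / 2 ^ k" if "X = (S + B) / 2 ^ k" "Y = (2 ^ k - 1) * S - B"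
    for S X Y B :: real
    using that by (simp add: field_simps)
  ultimately have "?S - (\<Sum>x<?N. \<Sum>y<?N. hier_weight k x y * (f x * f y))
      = (\<Sum>j<k. 2 ^ j * (?S - ?Q j)) / 2 ^ k"
    by blast
  then show ?thesis
    unfolding dirichlet_form_def by (simp only: card_lessThan)
qed

text \<open>
  All levels contribute nonnegatively to the Dirichlet form, and level \<open>0\<close>, the average over all
  vertices, contributes exactly \<open>1 / 2 ^ k\<close> times the variance.
\<close>

lemma hier_spectral_gap_graph:
  assumes "0 < k"
  shows "spectral_gap_graph {..<num_blocks k} (hier_weight k) (1 / 2 ^ k)"
proof -
  interpret unit_weight_graph "{..<num_blocks k}" "hier_weight k"
    using assms by (rule hier_unit_weight_graph)
  let ?N = "num_blocks k"
  show ?thesis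
  proof
    fix f :: "nat \<Rightarrow> real"
    let ?S = "\<Sum>x<?N. (f x)\<^sup>2"
    let ?Q = "\<lambda>i. \<Sum>x<?N. \<Sum>y<?N. level_kernel k i x y * (f x * f y)"
    have "?Q 0 = (\<Sum>x<?N. \<Sum>y<?N. f x * f y) / ?N"
      unfolding sum_divide_distrib
      by (intro sum.cong refl) (simp add: block_size_0 block_kernel_full)
    then have "?Q 0 = (\<Sum>x<?N. f x)\<^sup>2 / ?N"
      by (simp only: power2_eq_square sum_product)
    then have "1 / 2 ^ k * variance f = (\<Sum>i\<in>{0}. 2 ^ i * (?S - ?Q i)) / 2 ^ k / ?N"
      using num_blocks_pos[of k] by (simp add: variance_def power2_eq_square field_simps)
    also have "\<dots> \<le> (\<Sum>i<k. 2 ^ i * (?S - ?Q i)) / 2 ^ k / ?N"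
    proof (intro divide_right_mono sum_mono2)
      fix i
      show "0 \<le> 2 ^ i * (?S - ?Q i)"
        using block_kernel_quadratic_le[OF block_size_dvd_num_blocks, of k i f] by simp
    qed (use assms in auto)
    finally show "1 / 2 ^ k * variance f \<le> dirichlet_form f"
      by (simp only: hier_dirichlet_form[OF assms])
  qed simp
qed

text \<open>
  The test set is a block of level \<open>j\<close>, of measure \<open>1 / num_blocks j\<close>. Levels from \<open>j\<close> on do not leave it, and
  each coarser level \<open>i\<close> costs at most its rate \<open>2 ^ i / 2 ^ k\<close> times the variance, because its average
  of the indicator has at least the \<open>L\<^sup>2\<close> norm of the constant average.
\<close>

lemma hier_spectral_profile_le:
  assumes "0 < j" "j \<le> k"
  shows "spectral_profile {..<num_blocks k} (hier_weight k) (1 / num_blocks j) \<le> level_eigenvalue k j"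
proof -
  have k: "0 < k"
    using assms by simp
  interpret spectral_gap_graph "{..<num_blocks k}" "hier_weight k" "1 / 2 ^ k"
    using k by (rule hier_spectral_gap_graph)
  let ?N = "num_blocks k" and ?s = "block_size k j"
  let ?A = "{..<?s}"
  let ?f = "indicator ?A :: nat \<Rightarrow> real"
  have sN: "?s * num_blocks j = ?N"
    using assms(2) by (rule block_size_times_num_blocks)
  then have less: "?s < ?N"
    using num_blocks_ge_2[OF assms(1)] block_size_pos[of k j]
    by (metis One_nat_def Suc_1 Suc_le_lessD n_less_m_mult_n mult.commute)
  have sum_f: "(\<Sum>x<?N. ?f x) = ?s" "(\<Sum>x<?N. (?f x)\<^sup>2) = ?s"
  proof -
    have "(\<Sum>x<?N. ?f x) = (\<Sum>x<?s. 1)"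
      using less by (intro sum.mono_neutral_cong_right) auto
    then show "(\<Sum>x<?N. ?f x) = ?s"
      by simp
    moreover have "(?f x)\<^sup>2 = ?f x" for x
      by (simp add: indicator_def)
    ultimately show "(\<Sum>x<?N. (?f x)\<^sup>2) = ?s"
      by simp
  qed
  let ?Q = "\<lambda>i. \<Sum>x<?N. \<Sum>y<?N. level_kernel k i x y * (?f x * ?f y)"
  have Q: "?s - ?Q i \<le> (if i < j then ?s - (real ?s)\<^sup>2 / ?N else 0)" for i
  proof (cases "i < j")
    case True
    have "(real ?s)\<^sup>2 / ?N \<le> (real ?s)\<^sup>2 / block_size k i"
      using block_size_pos[of k i] block_size_le_num_blocks[of k i]
      by (intro divide_left_mono) (auto simp: num_blocks_pos)
    also have "\<dots> = ?Q i"
      using True by (simp add: block_kernel_indicator_large block_size_dvd block_size_pos block_size_le_num_blocks)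
    finally show ?thesis
      using True by simp
  next
    case False
    then show ?thesis
      by (simp add: block_kernel_indicator_small block_size_dvd block_size_le_num_blocks)
  qed
  have variance: "variance ?f = (?s - (real ?s)\<^sup>2 / ?N) / ?N"
    unfolding variance_def sum_f card_lessThan by (simp add: power2_eq_square diff_divide_distrib)
  have "dirichlet_form ?f = (\<Sum>i<k. 2 ^ i * (?s - ?Q i)) / 2 ^ k / ?N"
    by (simp only: hier_dirichlet_form[OF k] sum_f)
  also have "\<dots> \<le> (\<Sum>i<k. 2 ^ i * (if i < j then ?s - (real ?s)\<^sup>2 / ?N else 0)) / 2 ^ k / ?N"
    by (intro divide_right_mono sum_mono mult_left_mono Q) auto
  also have "(\<Sum>i<k. 2 ^ i * (if i < j then ?s - (real ?s)\<^sup>2 / ?N else 0))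
      = (\<Sum>i<j. 2 ^ i * (?s - (real ?s)\<^sup>2 / ?N))"
    using assms(2) by (intro sum.mono_neutral_cong_right) auto
  also have "\<dots> = (2 ^ j - 1) * (?s - (real ?s)\<^sup>2 / ?N)"
    by (simp only: sum_distrib_right[symmetric] sum_two_powers)
  also have "\<dots> / 2 ^ k / ?N = level_eigenvalue k j * variance ?f"
    by (simp add: variance level_eigenvalue_def)
  finally have "dirichlet_form ?f \<le> level_eigenvalue k j * variance ?f" .
  moreover have "?A \<subseteq> {..<?N}" "?A \<noteq> {}" "?A \<noteq> {..<?N}"
    using less block_size_pos[of k j] by auto
  ultimately have "set_eigenvalue {..<?N} (hier_weight k) ?A \<le> level_eigenvalue k j"
    by (intro set_eigenvalue_le)
  moreover have "card ?A / card {..<?N} \<le> 1 / num_blocks j"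
    using block_size_pos[of k j] num_blocks_pos[of j] by (simp add: field_simps flip: sN)
  ultimately show ?thesis
    using spectral_profile_le[of ?A "1 / num_blocks j"] less block_size_pos[of k j] by fastforce
qed

text \<open>
  Each step from level \<open>m\<close> to level \<open>m + 1\<close> multiplies the logarithmic scale \<open>log (1/r)\<close> by about two, and
  \<open>level_eigenvalue\<close> as well; hence every such interval contributes at least \<open>2 ^ k ln 2\<close>.
\<close>

lemma hier_profile_integral_ge:
  assumes "2 \<le> k"
  shows "real (k - 1) * ln 2 * 2 ^ k \<le> profile_integral {..<num_blocks k} (hier_weight k)"
proof -
  have k: "0 < k"
    using assms by simp
  interpret spectral_gap_graph "{..<num_blocks k}" "hier_weight k" "1 / 2 ^ k"
    using k by (rule hier_spectral_gap_graph)
  let ?N = "num_blocks k"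
  let ?\<Lambda> = "spectral_profile {..<?N} (hier_weight k)"
  let ?g = "\<lambda>r. 2 / (r * ?\<Lambda> r)"
  define a where "a j = 1 / real (num_blocks j)" for j
  have a_pos: "0 < a j" for j
    by (simp add: a_def num_blocks_pos)
  have a_anti: "a j \<le> a i" if "i \<le> j" for i j
    using num_blocks_mono[OF that] num_blocks_pos[of i] by (simp add: a_def frac_le)
  have a_ge: "1 / card {..<?N} \<le> a j" if "j \<le> k" for j
    using a_anti[OF that] by (simp add: a_def)
  have scales: "real m * ln 2 * 2 ^ k \<le> integral {a m..1} ?g" if "m < k" for m
    using that
  proof (induction m)
    case 0
    then show ?case
      by (simp add: a_def num_blocks_0)
  next
    case (Suc m)
    have ln_diff: "ln (a m) - ln (a (Suc m)) = 2 ^ m * ln 2"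
      using num_blocks_pos[of m] by (simp add: a_def ln_div num_blocks_Suc ln_mult ln_realpow)
    have "(1::real) < 2 ^ Suc m"
      by (intro one_less_power) auto
    then have "1 \<le> 2 * 2 ^ m / (2 ^ Suc m - 1 :: real)"
      by (subst pos_le_divide_eq) (simp_all del: one_less_power)
    then have "ln 2 * 2 ^ k * 1 \<le> ln 2 * 2 ^ k * (2 * 2 ^ m / (2 ^ Suc m - 1 :: real))"
      by (intro mult_left_mono) auto
    also have "\<dots> = 2 / level_eigenvalue k (Suc m) * (ln (a m) - ln (a (Suc m)))"
      unfolding ln_diff by (simp add: level_eigenvalue_def)
    also have "\<dots> \<le> integral {a (Suc m)..a m} ?g"
      using Suc.prems hier_spectral_profile_le[of "Suc m" k]
      by (intro profile_integral_segment_ge a_ge a_anti) (auto simp: a_def)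
    finally have "ln 2 * 2 ^ k \<le> integral {a (Suc m)..a m} ?g"
      by simp
    moreover have "integral {a (Suc m)..a m} ?g + integral {a m..1} ?g = integral {a (Suc m)..1} ?g"
      using Suc.prems a_anti[of 0 m]
      by (intro Henstock_Kurzweil_Integration.integral_combine a_anti profile_integrand_integrable a_ge)
        (auto simp: a_def num_blocks_0)
    ultimately show ?case
      using Suc by (simp add: algebra_simps)
  qed
  \<comment> \<open>The integral starts at \<open>4 / n\<close>, which leaves room for the levels up to \<open>k - 1\<close> only.\<close>
  have "4 \<le> (2::nat) ^ (2 ^ (k - 1))"
  proof -
    have "(2::nat) ^ 1 \<le> 2 ^ (k - 1)"
      using assms by (intro power_increasing) auto
    then have "(2::nat) ^ 2 \<le> 2 ^ (2 ^ (k - 1))"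
      by (intro power_increasing) auto
    then show ?thesis
      by simp
  qed
  then have "4 * num_blocks (k - 1) \<le> ?N"
    using k num_blocks_Suc[of "k - 1"] by simp
  then have "real 4 * real (num_blocks (k - 1)) \<le> real ?N"
    by (metis of_nat_le_iff of_nat_mult)
  then have start: "4 / ?N \<le> a (k - 1)"
    using num_blocks_pos[of k] num_blocks_pos[of "k - 1"] by (simp add: a_def field_simps)
  have start_ge: "1 / card {..<?N} \<le> 4 / ?N"
    by (simp add: divide_right_mono)
  have "real (k - 1) * ln 2 * 2 ^ k \<le> integral {a (k - 1)..1} ?g"
    using k by (intro scales) simp
  also have "\<dots> \<le> integral {4 / ?N..8} ?g"
  proof (rule integral_subset_le)
    show "{a (k - 1)..1} \<subseteq> {4 / ?N..8}"
      using start by auto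
    show "\<forall>r\<in>{4 / ?N..8}. 0 \<le> ?g r"
      using start_ge by (intro ballI profile_integrand_nonneg) auto
  qed (use start_ge in \<open>auto intro!: profile_integrand_integrable a_ge\<close>)
  also have "\<dots> = profile_integral {..<?N} (hier_weight k)"
    by (simp add: profile_integral_def pi_star_eq)
  finally show ?thesis .
qed

section \<open>The lower bound\<close>

lemma hier_connected:
  assumes "0 < k"
  shows "connected_graph {..<num_blocks k} (hier_weight k)"
  unfolding connected_graph_def using hier_weight_pos[OF assms] by auto

lemma num_blocks_at_top: "filterlim num_blocks at_top sequentially"
proof (rule filterlim_subseq)
  show "strict_mono num_blocks"
    unfolding strict_mono_Suc_iff num_blocks_Suc
  proof
    fix j
    have "(1::nat) < 2 ^ (2 ^ j)"
      by (intro one_less_power) auto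
    then show "num_blocks j < num_blocks j * 2 ^ (2 ^ j)"
      using num_blocks_pos[of j] by simp
  qed
qed

lemma log_log_num_blocks:
  assumes "0 < k"
  shows "log 2 (log 2 (num_blocks k)) \<le> k" "0 \<le> log 2 (log 2 (num_blocks k))"
proof -
  have log_n: "log 2 (num_blocks k) = 2 ^ k - 1"
    by (simp add: num_blocks_def of_nat_diff log_nat_power)
  have "(2::real) ^ 1 \<le> 2 ^ k"
    using assms by (intro power_increasing) auto
  then have ge: "1 \<le> (2::real) ^ k - 1"
    by simp
  have "log 2 (2 ^ k - 1) \<le> log 2 (2 ^ k)"
    using ge by (subst log_le_cancel_iff) auto
  then show "log 2 (log 2 (num_blocks k)) \<le> k"
    by (simp add: log_n log_nat_power)
  show "0 \<le> log 2 (log 2 (num_blocks k))"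
    using ge by (simp add: log_n)
qed

lemma hier_profile_integral_ge_mixing:
  assumes "2 \<le> k"
  shows "1 / 8 * mixing_time {..<num_blocks k} (hier_weight k) * log 2 (log 2 (num_blocks k))
    \<le> profile_integral {..<num_blocks k} (hier_weight k)"
proof -
  have k: "0 < k"
    using assms by simp
  have "1 / 8 * mixing_time {..<num_blocks k} (hier_weight k) * log 2 (log 2 (num_blocks k))
      \<le> 1 / 8 * (2 * 2 ^ k) * log 2 (log 2 (num_blocks k))"
    using hier_mixing_time_le[OF k] log_log_num_blocks(2)[OF k]
    by (intro mult_right_mono) auto
  also have "\<dots> \<le> 1 / 8 * (2 * 2 ^ k) * k"
    using log_log_num_blocks(1)[OF k] by (intro mult_left_mono) auto
  also have "\<dots> \<le> real (k - 1) * (1 / 2) * 2 ^ k"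
    using assms by (simp add: of_nat_diff)
  also have "\<dots> \<le> real (k - 1) * ln 2 * 2 ^ k"
    using ln2_ge_two_thirds by (intro mult_right_mono mult_left_mono) auto
  also have "\<dots> \<le> profile_integral {..<num_blocks k} (hier_weight k)"
    using assms by (rule hier_profile_integral_ge)
  finally show ?thesis .
qed

theorem theorem2:
  shows "\<exists>c::real. c > 0 \<and>
    (\<exists>(n :: nat \<Rightarrow> nat) (V :: nat \<Rightarrow> nat set) (w :: nat \<Rightarrow> nat \<Rightarrow> nat \<Rightarrow> real).
       (\<forall>k. 0 < n k) \<and> filterlim n at_top sequentially \<and>
       (\<forall>k. weighted_graph (V k) (w k) \<and> connected_graph (V k) (w k) \<and>
            card (V k) = n k \<and> pi_star (V k) (w k) = 1 / real (n k) \<and>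
            profile_integral (V k) (w k)
              \<ge> c * mixing_time (V k) (w k) * log 2 (log 2 (real (n k)))))"
proof (intro exI[of _ "1 / 8 :: real"] conjI exI[of _ "\<lambda>k. num_blocks (k + 2)"]
    exI[of _ "\<lambda>k. {..<num_blocks (k + 2)}"] exI[of _ "\<lambda>k. hier_weight (k + 2)"] allI)
  fix k
  interpret unit_weight_graph "{..<num_blocks (k + 2)}" "hier_weight (k + 2)"
    by (rule hier_unit_weight_graph) simp
  show "weighted_graph {..<num_blocks (k + 2)} (hier_weight (k + 2))"
    by (rule weighted_graph)
  show "pi_star {..<num_blocks (k + 2)} (hier_weight (k + 2)) = 1 / num_blocks (k + 2)"
    by (subst pi_star_eq) simp
  show "connected_graph {..<num_blocks (k + 2)} (hier_weight (k + 2))"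
    by (rule hier_connected) simp
  show "1 / 8 * mixing_time {..<num_blocks (k + 2)} (hier_weight (k + 2))
      * log 2 (log 2 (num_blocks (k + 2)))
    \<le> profile_integral {..<num_blocks (k + 2)} (hier_weight (k + 2))"
    by (rule hier_profile_integral_ge_mixing) simp
next
  show "filterlim (\<lambda>k. num_blocks (k + 2)) at_top sequentially"
    by (rule filterlim_compose[OF num_blocks_at_top filterlim_add_const_nat_at_top])
qed (auto simp: num_blocks_pos)

end
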